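(* Let $\mathcal X=\mathbb R^p$, $\mathcal Y=\mathbb R^d$, let $A:\mathcal X\to\mathcal Y$ be a (possibly nonlinear) function, let $y\in\mathcal Y$, and consider an ensemble $u^{(1)},\dots,u^{(J)}\in\mathcal X$ with weight fields $\kappa^{(j)}:\mathcal X\to\mathbb R$, $j=1,\dots,J$, satisfying $\sum_{j=1}^J\kappa^{(j)}(x)=1$ for all $x$, and such that $C_{u,u}^\kappa(x)$ is invertible for every $x\in\mathcal X$. Then the locally weighted ensemble Kalman inversion (lwEKI) system of ODEs $$\frac{\mathrm d}{\mathrm dt}u^{(i)}=-C_{u,A}^\kappa(u^{(i)})\,\bigl(A(u^{(i)})-y\bigr),\qquad i=1,\dots,J,$$ can equivalently be written as $$\frac{\mathrm d}{\mathrm dt}u^{(i)}=-C_{u,u}^\kappa(u^{(i)})\,\bigl(D_\kappa A(u^{(i)})\bigr)^\top\bigl(A(u^{(i)})-y\bigr)$$ and as $$\frac{\mathrm d}{\mathrm dt}u^{(i)}=-\sum_{j=1}^J\kappa^{(j)}(u^{(i)})\,\bigl(u^{(j)}-\mu^\kappa(u^{(i)})\bigr)\,\bigl\langle A(u^{(j)})-\mu_A^\kappa(u^{(i)}),\,A(u^{(i)})-y\bigr\rangle ,$$ i.e. the three right-hand sides coincide for each $i=1,\dots,J$.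
   Context: Locally weighted moments of the (time-dependent) ensemble: $\mu^\kappa(x)=\sum_j\kappa^{(j)}(x)u^{(j)}$, $\mu_A^\kappa(x)=\sum_j\kappa^{(j)}(x)A(u^{(j)})$, $C_{u,u}^\kappa(x)=\sum_j\kappa^{(j)}(x)(u^{(j)}-\mu^\kappa(x))(u^{(j)}-\mu^\kappa(x))^\top$, $C_{u,A}^\kappa(x)=\sum_j\kappa^{(j)}(x)(u^{(j)}-\mu^\kappa(x))(A(u^{(j)})-\mu_A^\kappa(x))^\top$, and $C_{A,u}^\kappa(x)=C_{u,A}^\kappa(x)^\top$. The weights may depend on the ensemble, e.g. $\kappa^{(i)}(x)=k(x,u^{(i)})/\sum_jk(x,u^{(j)})$ for a kernel $k$. The ensemble-based derivative of $A$ is $$D_\kappa A(x)[f]:=\sum_{i=1}^J\kappa^{(i)}(x)\,(A(u^{(i)})-\mu_A^\kappa(x))\,\langle u^{(i)}-\mu^\kappa(x),C_{u,u}^\kappa(x)^{-1}f\rangle=C_{A,u}^\kappa(x)C_{u,u}^\kappa(x)^{-1}f .$$ Inner products are Euclidean. *)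

theory Defs
  imports "HOL-Analysis.Analysis"
begin

text \<open>
  An ensemble of \<open>J = CARD('j)\<close> particles is a function \<open>u :: 'j \<Rightarrow> real^'p\<close> on the finite index
  type \<open>'j\<close>; a family of weight fields is a function \<open>w :: 'j \<Rightarrow> real^'p \<Rightarrow> real\<close>.
\<close>

definition outer_prod :: "real^'m \<Rightarrow> real^'n \<Rightarrow> real^'n^'m" where
  "outer_prod v z = (\<chi> r c. v $ r * z $ c)"

context
  fixes w :: "'j::finite \<Rightarrow> real^'p \<Rightarrow> real" and u :: "'j \<Rightarrow> real^'p"
begin

definition wmean :: "real^'p \<Rightarrow> real^'p" where
  "wmean x = (\<Sum>j\<in>UNIV. w j x *\<^sub>R u j)"

definition wmean_map :: "(real^'p \<Rightarrow> real^'d) \<Rightarrow> real^'p \<Rightarrow> real^'d" where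
  "wmean_map A x = (\<Sum>j\<in>UNIV. w j x *\<^sub>R A (u j))"

definition Cov_uu :: "real^'p \<Rightarrow> real^'p^'p" where
  "Cov_uu x = (\<Sum>j\<in>UNIV. w j x *\<^sub>R outer_prod (u j - wmean x) (u j - wmean x))"

definition Cov_uA :: "(real^'p \<Rightarrow> real^'d) \<Rightarrow> real^'p \<Rightarrow> real^'d^'p" where
  "Cov_uA A x = (\<Sum>j\<in>UNIV. w j x *\<^sub>R outer_prod (u j - wmean x) (A (u j) - wmean_map A x))"

definition ens_deriv :: "(real^'p \<Rightarrow> real^'d) \<Rightarrow> real^'p \<Rightarrow> real^'p \<Rightarrow> real^'d" where
  "ens_deriv A x f =
     (\<Sum>i\<in>UNIV. (w i x * ((u i - wmean x) \<bullet> (matrix_inv (Cov_uu x) *v f)))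
        *\<^sub>R (A (u i) - wmean_map A x))"

end

text \<open>
  Right-hand sides of the three systems. The weights \<open>\<kappa>\<close> take the current ensemble as their first
  argument, since they may depend on it (as for normalised kernel weights); weight fields that do
  not are the case of a constant function.
\<close>

context
  fixes A :: "real^'p \<Rightarrow> real^'d" and y :: "real^'d"
    and \<kappa> :: "('j::finite \<Rightarrow> real^'p) \<Rightarrow> 'j \<Rightarrow> real^'p \<Rightarrow> real"
begin

definition lwEKI_rhs :: "('j \<Rightarrow> real^'p) \<Rightarrow> 'j \<Rightarrow> real^'p" where
  "lwEKI_rhs u i = - (Cov_uA (\<kappa> u) u A (u i) *v (A (u i) - y))"

definition lwEKI_rhs_deriv :: "('j \<Rightarrow> real^'p) \<Rightarrow> 'j \<Rightarrow> real^'p" where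
  "lwEKI_rhs_deriv u i =
     - (Cov_uu (\<kappa> u) u (u i) *v
         (transpose (matrix (ens_deriv (\<kappa> u) u A (u i))) *v (A (u i) - y)))"

definition lwEKI_rhs_sum :: "('j \<Rightarrow> real^'p) \<Rightarrow> 'j \<Rightarrow> real^'p" where
  "lwEKI_rhs_sum u i =
     - (\<Sum>j\<in>UNIV. (\<kappa> u j (u i) * ((A (u j) - wmean_map (\<kappa> u) u A (u i)) \<bullet> (A (u i) - y)))
          *\<^sub>R (u j - wmean (\<kappa> u) u (u i)))"

end

definition solves_system ::
  "(('j \<Rightarrow> real^'p) \<Rightarrow> 'j \<Rightarrow> real^'p) \<Rightarrow> real set \<Rightarrow> (real \<Rightarrow> 'j \<Rightarrow> real^'p) \<Rightarrow> bool" where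
  "solves_system F T U \<longleftrightarrow>
     (\<forall>t\<in>T. \<forall>i. ((\<lambda>s. U s i) has_vector_derivative F (U t) i) (at t within T))"

end

theory Submission
  imports Defs
begin

text \<open>
  Since \<open>D_\<kappa> A(x) = C_{A,u} C_{u,u}\<inverse>\<close> and \<open>C_{u,u}\<close> is symmetric, the inverse cancels in
  \<open>C_{u,u} (D_\<kappa> A(x))\<^sup>T = C_{u,u} (C_{u,u}\<inverse>)\<^sup>T C_{u,A} = C_{u,A}\<close>.
  The third form expands \<open>C_{u,A}\<close> as a sum of rank-one matrices.
\<close>

lemma sum_matrix_vector_mult:
  fixes M :: "'i \<Rightarrow> real^'n^'m"
  shows "(\<Sum>j\<in>S. M j) *v b = (\<Sum>j\<in>S. M j *v b)"
  by (induction S rule: infinite_finite_induct) (simp_all add: matrix_vector_mult_add_rdistrib)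

lemma transpose_sum:
  fixes M :: "'i \<Rightarrow> real^'n^'m"
  shows "transpose (\<Sum>j\<in>S. M j) = (\<Sum>j\<in>S. transpose (M j))"
  by (simp add: transpose_def vec_eq_iff)

text \<open>The bridge between the matrix forms and the sums of inner products.\<close>

lemma outer_prod_mult_vector: "outer_prod v z *v b = (z \<bullet> b) *\<^sub>R v"
  by (simp add: outer_prod_def matrix_vector_mult_def inner_vec_def vec_eq_iff
      sum_distrib_left mult_ac)

lemma transpose_outer_prod: "transpose (outer_prod v z) = outer_prod z v"
  by (simp add: outer_prod_def transpose_def vec_eq_iff mult.commute)

text \<open>Each summand is the outer product of a vector with itself.\<close>

lemma transpose_Cov_uu: "transpose (Cov_uu w u x) = Cov_uu w u x"
  by (simp add: Cov_uu_def transpose_sum transpose_scalar transpose_outer_prod)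

lemma Cov_uA_mult_vector:
  "Cov_uA w u A x *v b =
    (\<Sum>j\<in>UNIV. (w j x * ((A (u j) - wmean_map w u A x) \<bullet> b)) *\<^sub>R (u j - wmean w u x))"
  by (simp add: Cov_uA_def sum_matrix_vector_mult scaleR_matrix_vector_assoc[symmetric]
      outer_prod_mult_vector)

lemma matrix_ens_deriv:
  "matrix (ens_deriv w u A x) = transpose (Cov_uA w u A x) ** matrix_inv (Cov_uu w u x)"
proof -
  have "ens_deriv w u A x =
      (*v) (transpose (Cov_uA w u A x) ** matrix_inv (Cov_uu w u x))"
    by (rule ext) (simp add: ens_deriv_def Cov_uA_def transpose_sum transpose_scalar
        transpose_outer_prod sum_matrix_vector_mult scaleR_matrix_vector_assoc[symmetric]
        outer_prod_mult_vector flip: matrix_vector_mul_assoc)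
  then show ?thesis by simp
qed

lemma Cov_uu_mult_transpose_ens_deriv:
  assumes "invertible (Cov_uu w u x)"
  shows "Cov_uu w u x ** transpose (matrix (ens_deriv w u A x)) = Cov_uA w u A x"
proof -
  let ?C = "Cov_uu w u x"
  \<comment> \<open>Symmetry of \<open>?C\<close> itself reduces the claim to the left-inverse
    law.\<close>
  have "?C ** transpose (matrix_inv ?C) = transpose (matrix_inv ?C ** ?C)"
    by (simp add: matrix_transpose_mul transpose_Cov_uu)
  also have "\<dots> = mat 1"
    \<comment> \<open>\<open>matrix_inv\<close> is a choice among two-sided inverses, and
      invertibility provides one.\<close>
    using someI_ex[OF assms[unfolded invertible_def]] by (simp add: matrix_inv_def)
  finally show ?thesis
    by (simp add: matrix_ens_deriv matrix_transpose_mul matrix_mul_assoc)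
qed

lemma lwEKI_rhs_eq_deriv:
  assumes "invertible (Cov_uu (\<kappa> u) u (u i))"
  shows "lwEKI_rhs A y \<kappa> u i = lwEKI_rhs_deriv A y \<kappa> u i"
  \<comment> \<open>\<open>transpose_matrix_vector\<close> would turn
    \<open>transpose M *v b\<close> into \<open>b v* M\<close> and hide the matrix product to be
    cancelled.\<close>
  using assms by (simp add: lwEKI_rhs_def lwEKI_rhs_deriv_def matrix_vector_mul_assoc
      Cov_uu_mult_transpose_ens_deriv del: transpose_matrix_vector)

lemma lwEKI_rhs_eq_sum: "lwEKI_rhs A y \<kappa> u i = lwEKI_rhs_sum A y \<kappa> u i"
  by (simp add: lwEKI_rhs_def lwEKI_rhs_sum_def Cov_uA_mult_vector)

theorem lemma7:
  fixes A :: "real^'p \<Rightarrow> real^'d" and y :: "real^'d"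
    and \<kappa> :: "('j::finite \<Rightarrow> real^'p) \<Rightarrow> 'j \<Rightarrow> real^'p \<Rightarrow> real"
    and T :: "real set" and U :: "real \<Rightarrow> 'j \<Rightarrow> real^'p"
  assumes "\<And>t x. t \<in> T \<Longrightarrow> (\<Sum>j\<in>UNIV. \<kappa> (U t) j x) = 1"
    and "\<And>t x. t \<in> T \<Longrightarrow> invertible (Cov_uu (\<kappa> (U t)) (U t) x)"
  shows "(\<forall>t\<in>T. \<forall>i. lwEKI_rhs A y \<kappa> (U t) i = lwEKI_rhs_deriv A y \<kappa> (U t) i
                \<and> lwEKI_rhs A y \<kappa> (U t) i = lwEKI_rhs_sum A y \<kappa> (U t) i)
    \<and> (solves_system (lwEKI_rhs A y \<kappa>) T U \<longleftrightarrow> solves_system (lwEKI_rhs_deriv A y \<kappa>) T U)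
    \<and> (solves_system (lwEKI_rhs A y \<kappa>) T U \<longleftrightarrow> solves_system (lwEKI_rhs_sum A y \<kappa>) T U)"
  \<comment> \<open>The right-hand sides agree at \<open>U t\<close> for every \<open>t\<close> in
    \<open>T\<close>, so the derivative conditions coincide time by time.\<close>
  using assms(2) by (simp add: solves_system_def lwEKI_rhs_eq_deriv flip: lwEKI_rhs_eq_sum)

end
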